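(* Let $\gamma^p=(\gamma_i)_{i\in\mathcal M^p}$ be a given SINR vector of the primary users with $\gamma_i\ge\widehat\gamma_i$ for all $i\in\mathcal M^p$, such that the primary users can be protected at $\gamma^p$ in the absence of the secondary users. Then the feasible cognitive interference region $\mathbf F^{s\to p}_{\mathcal I}$ is a polyhedron, namely it is exactly the set of vectors $\mathbf I^{s\to p}\in\mathbb R^{B^p}$ satisfying the component-wise inequalities $$\mathbf 0\le \mathbf I^{s\to p}\qquad\text{and}\qquad \mathbf A^p\,\mathbf I^{s\to p}\le \mathbf C^p,$$ where $$\mathbf A^p=(\mathbf I-\mathbf H(\gamma^p))^{-1},\qquad \mathbf C^p=\mathbf\Phi^{p,\max}-(\mathbf I-\mathbf H(\gamma^p))^{-1}\mathbf N^p,$$ $\mathbf I$ is the $B^p\times B^p$ identity matrix, $\mathbf N^p=[N_1,\dots,N_{B^p}]^{T}$, and $\mathbf\Phi^{p,\max}=[\Phi_1^{\max},\dots,\Phi_{B^p}^{\max}]^{T}$ with $$\Phi_m^{\max}=\min_{i\in\mathcal M_m}\Big\{p_i^{\max}h_{mi}\frac{\gamma_i+1}{\gamma_i}\Big\}.$$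
   Context: Setting. There is a finite set of primary base stations (PBSs) $\mathcal B^p=\{1,\dots,B^p\}$ and a finite set of primary users (PUs) $\mathcal M^p$. Each PU $i$ is served by a PBS $b_i\in\mathcal B^p$; for $m\in\mathcal B^p$, $\mathcal M_m=\{i\in\mathcal M^p: b_i=m\}$, which is assumed nonempty. For a PU $i$ and PBS $m$, $h_{mi}>0$ is the path gain from $i$ to $m$; $N_m>0$ is the noise power at PBS $m$; $p_i^{\max}>0$ is the maximum transmit power of user $i$; $\widehat\gamma_i>0$ is the target SINR of user $i$. (Secondary users cause interference to the PBSs; the vector $\mathbf I^{s\to p}=[I^{s\to p}_1,\dots,I^{s\to p}_{B^p}]^T$ collects the total interference power caused by all secondary users to each PBS.) Matrix $\mathbf H$. Given $\gamma^p$, $\mathbf H(\gamma^p)$ is the $B^p\times B^p$ matrix with entries $$H_{mm}=\sum_{i\in\mathcal M_m}\frac{\gamma_i}{\gamma_i+1},\qquad H_{mn}=\sum_{i\in\mathcal M_n}\frac{h_{mi}}{h_{ni}}\frac{\gamma_i}{\gamma_i+1}\quad(m\ne n).$$ Powers as functions of the cognitive interference. For $\mathbf I^{s\to p}\in\mathbb R^{B^p}$, set $\mathbf\Phi^p(\gamma^p,\mathbf I^{s\to p})=(\mathbf I-\mathbf H(\gamma^p))^{-1}(\mathbf N^p+\mathbf I^{s\to p})=[\Phi_1,\dots,\Phi_{B^p}]^T$ and, for $i\in\mathcal M^p$, $$p_i(\gamma^p,\mathbf I^{s\to p})=\frac{\gamma_i}{\gamma_i+1}\cdot\frac{\Phi_{b_i}(\gamma^p,\mathbf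 I^{s\to p})}{h_{b_i i}}.$$ Feasible cognitive interference region (FCIR). It is the set of nonnegative interference vectors for which all PUs are protected: $$\mathbf F^{s\to p}_{\mathcal I}=\{\mathbf I^{s\to p}\in\mathbb R_+^{B^p}:\ 0\le p_i(\gamma^p,\mathbf I^{s\to p})\le p_i^{\max}\ \ \forall i\in\mathcal M_m,\ \forall m\in\mathcal B^p\}.$$ Standing assumption (PUs can be protected in the absence of secondary users): there are powers $0\le p_i\le p_i^{\max}$, $i\in\mathcal M^p$, such that $\gamma_i=\dfrac{h_{b_i i}p_i}{\sum_{j\in\mathcal M^p,\,j\ne i}h_{b_i j}p_j+N_{b_i}}$ for every $i\in\mathcal M^p$. (Under this assumption $\mathbf I-\mathbf H(\gamma^p)$ is invertible, so the quantities above are well defined.) *)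

theory Defs
  imports "HOL-Analysis.Analysis"
begin

text \<open>
  The type 'b indexes the primary base stations and the type 'u the primary users.
  Parameters: h m i is the path gain from user i to base station m, b i is the base
  station serving user i, N is the vector of noise powers, pmax i the maximum transmit
  power of user i, and g i the SINR of user i. Orders between vectors are component-wise.
\<close>

definition served :: "('u \<Rightarrow> 'b) \<Rightarrow> 'b \<Rightarrow> 'u set" where
  "served b m = {i. b i = m}"

definition H_matrix ::
  "('b::finite \<Rightarrow> 'u::finite \<Rightarrow> real) \<Rightarrow> ('u \<Rightarrow> 'b) \<Rightarrow> ('u \<Rightarrow> real) \<Rightarrow> real ^ 'b ^ 'b" where
  "H_matrix h b g = (\<chi> m n.
     if m = n then (\<Sum>i\<in>served b m. g i / (g i + 1))
     else (\<Sum>i\<in>served b n. h m i / h n i * (g i / (g i + 1))))"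

definition Phi ::
  "('b::finite \<Rightarrow> 'u::finite \<Rightarrow> real) \<Rightarrow> ('u \<Rightarrow> 'b) \<Rightarrow> real ^ 'b \<Rightarrow> ('u \<Rightarrow> real)
    \<Rightarrow> real ^ 'b \<Rightarrow> real ^ 'b" where
  "Phi h b N g I = matrix_inv (mat 1 - H_matrix h b g) *v (N + I)"

definition pu_power ::
  "('b::finite \<Rightarrow> 'u::finite \<Rightarrow> real) \<Rightarrow> ('u \<Rightarrow> 'b) \<Rightarrow> real ^ 'b \<Rightarrow> ('u \<Rightarrow> real)
    \<Rightarrow> real ^ 'b \<Rightarrow> 'u \<Rightarrow> real" where
  "pu_power h b N g I i = g i / (g i + 1) * (Phi h b N g I $ b i / h (b i) i)"

text \<open>Feasible cognitive interference region.\<close>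

definition FCIR ::
  "('b::finite \<Rightarrow> 'u::finite \<Rightarrow> real) \<Rightarrow> ('u \<Rightarrow> 'b) \<Rightarrow> real ^ 'b \<Rightarrow> ('u \<Rightarrow> real)
    \<Rightarrow> ('u \<Rightarrow> real) \<Rightarrow> (real ^ 'b) set" where
  "FCIR h b N pmax g = {I. 0 \<le> I \<and>
     (\<forall>m. \<forall>i\<in>served b m. 0 \<le> pu_power h b N g I i \<and> pu_power h b N g I i \<le> pmax i)}"

text \<open>The SINR vector g is attained by admissible powers in the absence of secondary users.\<close>

definition protectable ::
  "('b::finite \<Rightarrow> 'u::finite \<Rightarrow> real) \<Rightarrow> ('u \<Rightarrow> 'b) \<Rightarrow> real ^ 'b \<Rightarrow> ('u \<Rightarrow> real)
    \<Rightarrow> ('u \<Rightarrow> real) \<Rightarrow> bool" where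
  "protectable h b N pmax g \<longleftrightarrow> (\<exists>p :: 'u \<Rightarrow> real.
     (\<forall>i. 0 \<le> p i \<and> p i \<le> pmax i) \<and>
     (\<forall>i. g i = h (b i) i * p i / ((\<Sum>j\<in>UNIV - {i}. h (b i) j * p j) + N $ b i)))"

definition Phi_max ::
  "('b::finite \<Rightarrow> 'u::finite \<Rightarrow> real) \<Rightarrow> ('u \<Rightarrow> 'b) \<Rightarrow> ('u \<Rightarrow> real) \<Rightarrow> ('u \<Rightarrow> real)
    \<Rightarrow> real ^ 'b" where
  "Phi_max h b pmax g =
     (\<chi> m. Min ((\<lambda>i. pmax i * h m i * ((g i + 1) / g i)) ` served b m))"

definition A_matrix ::
  "('b::finite \<Rightarrow> 'u::finite \<Rightarrow> real) \<Rightarrow> ('u \<Rightarrow> 'b) \<Rightarrow> ('u \<Rightarrow> real) \<Rightarrow> real ^ 'b ^ 'b" where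
  "A_matrix h b g = matrix_inv (mat 1 - H_matrix h b g)"

definition C_vector ::
  "('b::finite \<Rightarrow> 'u::finite \<Rightarrow> real) \<Rightarrow> ('u \<Rightarrow> 'b) \<Rightarrow> real ^ 'b \<Rightarrow> ('u \<Rightarrow> real)
    \<Rightarrow> ('u \<Rightarrow> real) \<Rightarrow> real ^ 'b" where
  "C_vector h b N pmax g =
     Phi_max h b pmax g - matrix_inv (mat 1 - H_matrix h b g) *v N"

end

theory Submission
  imports Defs
begin

text \<open>
  The total received powers \<open>\<Phi> m = (\<Sum>j. h m j * p j) + N m\<close> of an admissible power vector
  satisfy \<open>\<Phi> = H \<Phi> + N\<close> with \<open>\<Phi> > 0\<close> and \<open>N > 0\<close>. For the nonnegative matrix \<open>H\<close> this makes
  \<open>I - H\<close> inverse-positive: comparing \<open>x\<close> with \<open>\<Phi>\<close> at the index minimizing \<open>x m / \<Phi> m\<close> shows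
  that \<open>(I - H) x \<ge> 0\<close> forces \<open>x \<ge> 0\<close>. Hence nonnegative cognitive interference always gives
  nonnegative powers, and only the upper power limits constrain the region.
\<close>

text \<open>Each row of \<open>A\<close> contributes one half-space, and there are finitely many
  rows.\<close>

lemma polyhedron_matrix_le:
  fixes A :: "real ^ 'n::finite ^ 'm::finite"
  shows "polyhedron {x. A *v x \<le> c}"
proof -
  have "{x. A *v x \<le> c} = (\<Inter>m. {x. A $ m \<bullet> x \<le> c $ m})"
    by (auto simp: less_eq_vec_def matrix_vector_mul_component)
  also have "polyhedron \<dots>"
    by (rule polyhedron_Inter) (auto simp: polyhedron_halfspace_le)
  finally show ?thesis .
qed

lemma nonneg_of_mult_nonneg:
  fixes H :: "real ^ 'n::finite ^ 'n"
  assumes H: "\<And>m n. 0 \<le> H $ m $ n"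
    and pos: "\<And>m. 0 < v $ m"
    and sub: "\<And>m. (H *v v) $ m < v $ m"
    and x: "0 \<le> (mat 1 - H) *v x"
  shows "0 \<le> x"
proof -
  obtain k where k: "\<And>m. x $ k / v $ k \<le> x $ m / v $ m"
  proof -
    let ?R = "range (\<lambda>m. x $ m / v $ m)"
    have "Min ?R \<in> ?R" by (rule Min_in) auto
    then obtain k where "Min ?R = x $ k / v $ k" by (rule rangeE)
    moreover have "Min ?R \<le> x $ m / v $ m" for m by (rule Min_le) auto
    ultimately show ?thesis using that by auto
  qed
  \<comment> \<open>\<open>t\<close> is the largest factor with \<open>t * v\<close> below
    \<open>x\<close> component-wise; equality holds at index \<open>k\<close>.\<close>
  define t where "t = x $ k / v $ k"
  have ge: "t * v $ m \<le> x $ m" for m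
    using k[of m] pos[of m] by (simp add: t_def pos_le_divide_eq)
  have "0 \<le> t"
  proof (rule ccontr)
    assume "\<not> 0 \<le> t"
    then have t: "t < 0" by simp
    \<comment> \<open>The negative factor \<open>t\<close> reverses \<open>sub\<close>. Monotonicity
      of \<open>H\<close> and row \<open>k\<close> of \<open>H *v x \<le> x\<close> then lead back
      to \<open>t * v $ k\<close>, a strict cycle.\<close>
    have "t * v $ k < t * (H *v v) $ k"
      using sub[of k] t by (simp add: mult_less_cancel_left)
    also have "\<dots> = (\<Sum>n\<in>UNIV. H $ k $ n * (t * v $ n))"
      by (simp add: matrix_vector_mult_def sum_distrib_left mult_ac)
    also have "\<dots> \<le> (\<Sum>n\<in>UNIV. H $ k $ n * x $ n)"
      by (intro sum_mono mult_left_mono ge H)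
    also have "\<dots> = (H *v x) $ k" by (simp add: matrix_vector_mult_def)
    also have "\<dots> \<le> x $ k"
      using x by (simp add: less_eq_vec_def matrix_vector_mult_diff_rdistrib)
    also have "x $ k = t * v $ k" using pos[of k] by (simp add: t_def)
    finally show False by simp
  qed
  then have "0 \<le> x $ m" for m
    using ge[of m] pos[of m] by (meson less_imp_le mult_nonneg_nonneg order_trans)
  then show ?thesis by (simp add: less_eq_vec_def)
qed

lemma matrix_inv_nonneg:
  fixes H :: "real ^ 'n::finite ^ 'n"
  assumes H: "\<And>m n. 0 \<le> H $ m $ n"
    and pos: "\<And>m. 0 < v $ m"
    and sub: "\<And>m. (H *v v) $ m < v $ m"
    and y: "0 \<le> y"
  shows "0 \<le> matrix_inv (mat 1 - H) *v y"
proof -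
  let ?A = "mat 1 - H"
  note nonneg = nonneg_of_mult_nonneg[OF H pos sub]
  \<comment> \<open>A kernel vector and its negative are both mapped to 0, so both are nonnegative;
    the trivial kernel gives invertibility.\<close>
  have "x = 0" if "?A *v x = 0" for x
  proof -
    have "?A *v (- x) = 0"
      using that matrix_vector_mult_diff_distrib[of ?A 0 x] by simp
    then have "0 \<le> x" "0 \<le> - x"
      using nonneg[of x] nonneg[of "- x"] that by auto
    then show ?thesis by (simp add: less_eq_vec_def vec_eq_iff order_antisym)
  qed
  then have "invertible ?A"
    by (auto simp: invertible_left_inverse matrix_left_invertible_ker)
  then have "?A ** matrix_inv ?A = mat 1"
    unfolding invertible_def matrix_inv_def by (rule someI2_ex) (rule conjunct1)
  then have "?A *v (matrix_inv ?A *v y) = y"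
    by (simp add: matrix_vector_mul_assoc)
  with y show ?thesis by (metis nonneg)
qed

lemma H_matrix_nonneg:
  assumes "\<And>m i. h m i > 0" and "\<And>i. g i > 0"
  shows "0 \<le> H_matrix h b g $ m $ n"
  using assms by (auto simp: H_matrix_def less_imp_le
      intro!: sum_nonneg mult_nonneg_nonneg divide_nonneg_nonneg add_nonneg_nonneg)

text \<open>On the diagonal the gain ratio is 1, so one formula covers both cases of the
  definition.\<close>

lemma H_matrix_component:
  assumes "\<And>m i. h m i > 0"
  shows "H_matrix h b g $ m $ n = (\<Sum>i\<in>served b n. h m i / h n i * (g i / (g i + 1)))"
  using assms[THEN less_imp_neq] by (auto simp: H_matrix_def intro!: sum.cong)

lemma protectable_imp_subinvariant:
  assumes h: "\<And>m i. h m i > 0" and N: "\<And>m. N $ m > 0" and g: "\<And>i. g i > 0"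
    and prot: "protectable h b N pmax g"
  obtains v where "\<And>m. 0 < v $ m" "\<And>m. (H_matrix h b g *v v) $ m < v $ m"
proof -
  obtain p where p: "\<And>i. 0 \<le> p i"
    and sinr: "\<And>i. g i = h (b i) i * p i / ((\<Sum>j\<in>UNIV - {i}. h (b i) j * p j) + N $ b i)"
    using prot by (auto simp: protectable_def)
  \<comment> \<open>Total power received at each base station: all user signals plus noise.\<close>
  define v where "v = (\<chi> m. (\<Sum>j\<in>UNIV. h m j * p j) + N $ m)"
  \<comment> \<open>With \<open>D\<close> the interference plus noise seen by user \<open>i\<close>,
    the signal is \<open>g i * D\<close> and the total is \<open>(g i + 1) * D\<close>, so the
    signal is the fraction \<open>g i / (g i + 1)\<close> of the total.\<close>
  have pow: "g i / (g i + 1) * v $ b i = h (b i) i * p i" for i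
  proof -
    define D where "D = (\<Sum>j\<in>UNIV - {i}. h (b i) j * p j) + N $ b i"
    have "0 < D" unfolding D_def
      by (intro add_nonneg_pos sum_nonneg mult_nonneg_nonneg p N less_imp_le[OF h])
    then have gD: "g i * D = h (b i) i * p i" using sinr[of i] by (simp add: D_def)
    have "v $ b i = h (b i) i * p i + D"
      by (simp add: v_def D_def sum.remove[of UNIV i])
    also have "\<dots> = (g i + 1) * D" using gD by (simp add: algebra_simps)
    finally show ?thesis using gD g[of i] by simp
  qed
  have "(H_matrix h b g *v v) $ m = (\<Sum>j\<in>UNIV. h m j * p j)" for m
  proof -
    have "(H_matrix h b g *v v) $ m
        = (\<Sum>n\<in>UNIV. \<Sum>i\<in>served b n. h m i / h n i * (g i / (g i + 1)) * v $ n)"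
      by (simp add: matrix_vector_mult_def H_matrix_component[OF h] sum_distrib_right)
    also have "\<dots> = (\<Sum>n\<in>UNIV. \<Sum>i\<in>served b n. h m i * p i)"
    proof (intro sum.cong refl)
      fix n i assume "i \<in> served b n"
      then have "b i = n" by (simp add: served_def)
      then have "h m i / h n i * (g i / (g i + 1)) * v $ n = h m i / h n i * (h n i * p i)"
        using pow[of i] by (metis mult.assoc)
      then show "h m i / h n i * (g i / (g i + 1)) * v $ n = h m i * p i"
        using h[of n i] by simp
    qed
    \<comment> \<open>The sets \<open>served b n\<close> partition the users, each user having
      exactly one serving station.\<close>
    also have "\<dots> = (\<Sum>i\<in>UNIV. h m i * p i)"
      using sum.group[of UNIV UNIV b "\<lambda>i. h m i * p i"] by (simp add: served_def)
    finally show ?thesis .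
  qed
  moreover have "0 < v $ m" for m
    by (auto simp: v_def N intro!: add_nonneg_pos sum_nonneg mult_nonneg_nonneg p less_imp_le[OF h])
  ultimately show ?thesis using that[of v] N by (simp add: v_def)
qed

lemma pu_power_nonneg:
  assumes "h (b i) i > 0" and "g i > 0" and "0 \<le> Phi h b N g I"
  shows "0 \<le> pu_power h b N g I i"
  using assms unfolding pu_power_def less_eq_vec_def
  by (intro mult_nonneg_nonneg divide_nonneg_nonneg) (auto simp: less_imp_le)

lemma pu_power_le_iff:
  assumes "h (b i) i > 0" and "g i > 0"
  shows "pu_power h b N g I i \<le> P \<longleftrightarrow> Phi h b N g I $ b i \<le> P * h (b i) i * ((g i + 1) / g i)"
proof -
  have "pu_power h b N g I i = Phi h b N g I $ b i / (h (b i) i * ((g i + 1) / g i))"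
    by (simp add: pu_power_def) (simp only: mult.commute)
  moreover have "0 < h (b i) i * ((g i + 1) / g i)" using assms by simp
  ultimately show ?thesis by (simp only: pos_divide_le_eq mult.assoc)
qed

text \<open>All users of station \<open>m\<close> share the value \<open>Phi h b N g I $ m\<close>,
  so their limits combine into a single bound by the minimum, taken over a nonempty finite
  set.\<close>

lemma all_pu_power_le_iff:
  assumes served: "\<And>m. served b m \<noteq> {}"
    and h: "\<And>m i. h m i > 0" and g: "\<And>i. g i > 0"
  shows "(\<forall>i. pu_power h b N g I i \<le> pmax i) \<longleftrightarrow> Phi h b N g I \<le> Phi_max h b pmax g"
proof -
  have "Phi h b N g I $ m \<le> Phi_max h b pmax g $ m
      \<longleftrightarrow> (\<forall>i\<in>served b m. Phi h b N g I $ m \<le> pmax i * h m i * ((g i + 1) / g i))" for m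
    using served[of m] by (simp add: Phi_max_def)
  then show ?thesis
    by (auto simp: less_eq_vec_def pu_power_le_iff[OF h g] served_def)
qed

text \<open>\<open>Phi\<close> is affine in \<open>I\<close>; its constant term, the noise
  contribution, moves to the right-hand side.\<close>

lemma Phi_le_Phi_max_iff:
  "Phi h b N g I \<le> Phi_max h b pmax g \<longleftrightarrow> A_matrix h b g *v I \<le> C_vector h b N pmax g"
  by (simp add: Phi_def A_matrix_def C_vector_def matrix_vector_right_distrib less_eq_vec_def
      algebra_simps)

theorem theorem2:
  fixes h :: "'b::finite \<Rightarrow> 'u::finite \<Rightarrow> real"
    and b :: "'u \<Rightarrow> 'b"
    and N :: "real ^ 'b"
    and pmax \<gamma>_target \<gamma> :: "'u \<Rightarrow> real"
  assumes "\<And>m. served b m \<noteq> {}"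
    and "\<And>m i. h m i > 0"
    and "\<And>m. N $ m > 0"
    and "\<And>i. pmax i > 0"
    and "\<And>i. \<gamma>_target i > 0"
    and "\<And>i. \<gamma> i \<ge> \<gamma>_target i"
    and "protectable h b N pmax \<gamma>"
  shows "polyhedron (FCIR h b N pmax \<gamma>) \<and>
    FCIR h b N pmax \<gamma> =
      {I :: real ^ 'b. 0 \<le> I \<and> A_matrix h b \<gamma> *v I \<le> C_vector h b N pmax \<gamma>}"
proof -
  have \<gamma>: "\<gamma> i > 0" for i
    using assms(5)[of i] assms(6)[of i] by simp
  obtain v where v: "\<And>m. 0 < v $ m" "\<And>m. (H_matrix h b \<gamma> *v v) $ m < v $ m"
    using protectable_imp_subinvariant[OF assms(2,3) \<gamma> assms(7)] by blast
  have "0 \<le> Phi h b N \<gamma> I" if "0 \<le> I" for I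
    unfolding Phi_def using that assms(3)
    by (intro matrix_inv_nonneg[OF H_matrix_nonneg[OF assms(2) \<gamma>] v])
       (simp add: less_eq_vec_def less_imp_le)
  then have nonneg: "0 \<le> pu_power h b N \<gamma> I i" if "0 \<le> I" for I i
    using that by (intro pu_power_nonneg assms(2) \<gamma>)
  have "(\<forall>i. pu_power h b N \<gamma> I i \<le> pmax i)
      \<longleftrightarrow> A_matrix h b \<gamma> *v I \<le> C_vector h b N pmax \<gamma>" for I
    by (simp only: all_pu_power_le_iff[where h = h and g = \<gamma>, OF assms(1,2) \<gamma>] Phi_le_Phi_max_iff)
  then have eq: "FCIR h b N pmax \<gamma> =
      {I. 0 \<le> I \<and> A_matrix h b \<gamma> *v I \<le> C_vector h b N pmax \<gamma>}"
    using nonneg unfolding FCIR_def served_def by blast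
  \<comment> \<open>This puts the constraint \<open>0 \<le> I\<close> into the form required by
    \<open>polyhedron_matrix_le\<close>.\<close>
  have "(- mat 1) *v I = - I" for I :: "real ^ 'b"
    using matrix_vector_mult_diff_rdistrib[of 0 "mat 1" I] by simp
  then have "{I :: real ^ 'b. 0 \<le> I \<and> A_matrix h b \<gamma> *v I \<le> C_vector h b N pmax \<gamma>} =
      {I. (- mat 1) *v I \<le> 0} \<inter> {I. A_matrix h b \<gamma> *v I \<le> C_vector h b N pmax \<gamma>}"
    by (auto simp: less_eq_vec_def)
  then show ?thesis
    unfolding eq by (simp add: polyhedron_matrix_le)
qed

end
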